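(* Let $G$ be a connected graph of order at least $2$ and let $u\in V(G)$. Then $$\xi^{-}(G) \le \xi_G(u) \le \xi(G)\le {\rm gp}(G) \leq 2\xi^{-}(G)\,.$$
   Context: All graphs are finite, simple and connected. For vertices $x,y$ of $G$, $d_G(x,y)$ is the length of a shortest $x,y$-path and $I_G[x,y]=\{w: d_G(x,y)=d_G(x,w)+d_G(w,y)\}$. A set $X\subseteq V(G)$ is a general position set if every shortest path $P$ of $G$ satisfies $|V(P)\cap X|\le 2$; ${\rm gp}(G)$ is the maximum cardinality of a general position set of $G$. For $u\in V(G)$, a set $S\subseteq V(G)$ is $u$-colinear if $S$ is a general position set, $u\notin S$, and $y\notin I_G[x,u]$ for all $x,y\in S$ (with $x \neq y$). $\xi_G(u)$ is the maximum cardinality of a $u$-colinear set, $\xi^{-}(G)=\min_{u\in V(G)}\xi_G(u)$ and $\xi(G)=\max_{u\in V(G)}\xi_G(u)$. *)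

theory Defs
  imports "Graph_Theory.Graph_Theory"
begin

text \<open>
  A finite simple undirected graph is a symmetric digraph in the sense of the locale
  \<^locale>\<open>graph\<close>. Paths are given by their arc lists, so \<^term>\<open>length p\<close> is
  the number of edges of the path \<^term>\<open>p\<close>.
\<close>

definition graph_dist :: "('a, 'b) pre_digraph \<Rightarrow> 'a \<Rightarrow> 'a \<Rightarrow> nat" where
  "graph_dist G x y = (LEAST n. \<exists>p. pre_digraph.apath G x p y \<and> length p = n)"

definition shortest_path :: "('a, 'b) pre_digraph \<Rightarrow> 'a \<Rightarrow> 'b awalk \<Rightarrow> 'a \<Rightarrow> bool" where
  "shortest_path G x p y \<longleftrightarrow> pre_digraph.apath G x p y \<and> length p = graph_dist G x y"

definition graph_interval :: "('a, 'b) pre_digraph \<Rightarrow> 'a \<Rightarrow> 'a \<Rightarrow> 'a set" where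
  "graph_interval G x y =
     {w \<in> verts G. graph_dist G x y = graph_dist G x w + graph_dist G w y}"

definition general_position_set :: "('a, 'b) pre_digraph \<Rightarrow> 'a set \<Rightarrow> bool" where
  "general_position_set G X \<longleftrightarrow> X \<subseteq> verts G \<and>
     (\<forall>x p y. shortest_path G x p y \<longrightarrow> card (set (pre_digraph.awalk_verts G x p) \<inter> X) \<le> 2)"

definition gp :: "('a, 'b) pre_digraph \<Rightarrow> nat" where
  "gp G = Max (card ` {X. general_position_set G X})"

definition colinear_set :: "('a, 'b) pre_digraph \<Rightarrow> 'a \<Rightarrow> 'a set \<Rightarrow> bool" where
  "colinear_set G u S \<longleftrightarrow> general_position_set G S \<and> u \<notin> S \<and>
     (\<forall>x\<in>S. \<forall>y\<in>S. x \<noteq> y \<longrightarrow> y \<notin> graph_interval G x u)"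

definition xi_at :: "('a, 'b) pre_digraph \<Rightarrow> 'a \<Rightarrow> nat" where
  "xi_at G u = Max (card ` {S. colinear_set G u S})"

definition xi_min :: "('a, 'b) pre_digraph \<Rightarrow> nat" where
  "xi_min G = Min (xi_at G ` verts G)"

definition xi_max :: "('a, 'b) pre_digraph \<Rightarrow> nat" where
  "xi_max G = Max (xi_at G ` verts G)"

end

theory Submission
  imports Defs
begin

text \<open>
  Order the vertices by \<open>y \<le> x\<close> iff \<open>y\<close> lies on a geodesic from \<open>x\<close> to \<open>u\<close>. A chain
  of three vertices in this order lies on a common geodesic, so every chain in a general position
  set \<open>X\<close> has at most two elements. If \<open>u \<notin> X\<close>, the maximal elements of \<open>X\<close> and the remaining
  ones are therefore two antichains covering \<open>X\<close>, both \<open>u\<close>-colinear, and the larger one has at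
  least \<open>card X / 2\<close> elements. If \<open>u \<in> X\<close>, already \<open>X - {u}\<close> is \<open>u\<close>-colinear.
\<close>

section \<open>Walks, geodesics, distances and aligned triples\<close>

context wf_digraph
begin

text \<open>Cutting closed pieces out of a walk keeps its ends and never lengthens it.\<close>

lemma apath_le_length_awalk:
  assumes "awalk x p y"
  shows "\<exists>q. apath x q y \<and> length q \<le> length p"
  using assms
proof (induction rule: awalk_to_apath_induct)
  case (path p)
  then show ?case by (auto simp: apath_def)
next
  case (decomp p q r s)
  have "p = q @ r @ s"
    using decomp by (blast elim: awalk_cyc_decompE)
  then show ?case using decomp.IH by force
qed

text \<open>\<open>graph_dist\<close> minimises over paths only; concatenated paths are merely
  walks, so the bound is extended to these.\<close>

lemma graph_dist_le_awalk:
  assumes "awalk x p y"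
  shows "graph_dist G x y \<le> length p"
proof -
  obtain q where "apath x q y" "length q \<le> length p"
    using apath_le_length_awalk[OF assms] by blast
  moreover from this(1) have "graph_dist G x y \<le> length q"
    unfolding graph_dist_def by (intro Least_le) blast
  ultimately show ?thesis by linarith
qed

lemma shortest_path_exists:
  assumes "x \<rightarrow>\<^sup>* y"
  obtains p where "shortest_path G x p y"
proof -
  have "\<exists>n p. apath x p y \<and> length p = n"
    using assms reachable_apath by blast
  then have "\<exists>p. apath x p y \<and> length p = graph_dist G x y"
    unfolding graph_dist_def by (rule LeastI_ex)
  then show ?thesis using that by (auto simp: shortest_path_def)
qed

lemma awalk_shortest_path: "shortest_path G x p y \<Longrightarrow> awalk x p y"
  by (simp add: shortest_path_def awalkI_apath)

lemma length_shortest_path: "shortest_path G x p y \<Longrightarrow> length p = graph_dist G x y"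
  by (simp add: shortest_path_def)

text \<open>A repeated vertex would bound a nonempty closed piece \<open>r\<close>, and removing it
  would leave a walk shorter than the distance.\<close>

lemma shortest_pathI:
  assumes "awalk x p y" "length p = graph_dist G x y"
  shows "shortest_path G x p y"
proof -
  have "distinct (awalk_verts x p)"
  proof (rule ccontr)
    assume "\<not> distinct (awalk_verts x p)"
    then obtain q r s w where "p = q @ r @ s" "0 < length r" "awalk x q w" "awalk w s y"
      using awalk_not_distinct_decomp[OF assms(1)] by blast
    moreover from this have "graph_dist G x y \<le> length (q @ s)"
      by (intro graph_dist_le_awalk) auto
    ultimately show False using assms(2) by (simp flip: length_greater_0_conv)
  qed
  then show ?thesis using assms by (simp add: shortest_path_def apath_def)
qed

lemma graph_dist_triangle:
  assumes "x \<rightarrow>\<^sup>* y" "y \<rightarrow>\<^sup>* z"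
  shows "graph_dist G x z \<le> graph_dist G x y + graph_dist G y z"
proof -
  obtain p q where "shortest_path G x p y" "shortest_path G y q z"
    using assms shortest_path_exists by metis
  then have "awalk x (p @ q) z" "length p = graph_dist G x y" "length q = graph_dist G y z"
    by (blast intro: awalk_appendI awalk_shortest_path length_shortest_path)+
  then show ?thesis using graph_dist_le_awalk[of x "p @ q" z] by simp
qed

lemma graph_dist_pos:
  assumes "x \<rightarrow>\<^sup>* y" "x \<noteq> y"
  shows "0 < graph_dist G x y"
proof -
  obtain p where p: "shortest_path G x p y"
    using assms(1) shortest_path_exists by blast
  have "p \<noteq> []"
    using awalk_shortest_path[OF p] assms(2) by (auto simp: awalk_Nil_iff)
  then show ?thesis using length_shortest_path[OF p] by (metis length_greater_0_conv)
qed

text \<open>If the distances add up, geodesics from \<open>x\<close> to \<open>y\<close> and from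
  \<open>y\<close> to \<open>z\<close> concatenate to a geodesic meeting \<open>X\<close> in three
  vertices.\<close>

lemma general_position_set_no_three_aligned:
  assumes X: "general_position_set G X" and xyz: "x \<in> X" "y \<in> X" "z \<in> X"
    and "x \<noteq> y" "y \<noteq> z" "x \<noteq> z" and reach: "x \<rightarrow>\<^sup>* y" "y \<rightarrow>\<^sup>* z"
  shows "graph_dist G x z \<noteq> graph_dist G x y + graph_dist G y z"
proof
  assume eq: "graph_dist G x z = graph_dist G x y + graph_dist G y z"
  obtain p q where p: "shortest_path G x p y" and q: "shortest_path G y q z"
    using reach shortest_path_exists by metis
  note pq = awalk_shortest_path[OF p] awalk_shortest_path[OF q]
  have "shortest_path G x (p @ q) z"
    using pq eq length_shortest_path[OF p] length_shortest_path[OF q]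
    by (intro shortest_pathI awalk_appendI) auto
  then have "card (set (awalk_verts x (p @ q)) \<inter> X) \<le> 2"
    using X by (auto simp: general_position_set_def)
  moreover have "z \<in> set (awalk_verts y q)"
    using pq(2) by (metis awalkE awalk_verts_non_Nil last_in_set)
  then have "{x, y, z} \<subseteq> set (awalk_verts x (p @ q)) \<inter> X"
    using pq xyz by (auto simp: set_awalk_verts_append hd_in_awalk_verts)
  then have "card {x, y, z} \<le> card (set (awalk_verts x (p @ q)) \<inter> X)"
    by (intro card_mono) auto
  ultimately show False using \<open>x \<noteq> y\<close> \<open>y \<noteq> z\<close> \<open>x \<noteq> z\<close> by simp
qed

text \<open>Chains are aligned triples. The case \<open>z = u\<close> is included, which later
  serves for \<open>u \<in> X\<close>.\<close>

lemma general_position_set_chain_le_two: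
  assumes X: "general_position_set G X" and sc: "strongly_connected G" and u: "u \<in> verts G"
    and xyz: "x \<in> X" "y \<in> X" "z \<in> X" and neq: "x \<noteq> y" "y \<noteq> z"
    and y: "y \<in> graph_interval G x u" and z: "z \<in> graph_interval G y u"
  shows False
proof -
  have verts: "x \<in> verts G" "y \<in> verts G" "z \<in> verts G"
    using X xyz by (auto simp: general_position_set_def)
  have reach: "a \<rightarrow>\<^sup>* b" if "a \<in> verts G" "b \<in> verts G" for a b
    using sc that by auto
  have eqs: "graph_dist G x u = graph_dist G x y + graph_dist G y u"
    "graph_dist G y u = graph_dist G y z + graph_dist G z u"
    using y z by (auto simp: graph_interval_def)
  have "0 < graph_dist G x y"
    using reach verts neq by (intro graph_dist_pos) auto
  \<comment> \<open>For \<open>x = z\<close> the two equations would add up to distance 0 between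
    \<open>x\<close> and \<open>y\<close>.\<close>
  then have "x \<noteq> z" using eqs by auto
  \<comment> \<open>The first inequality with \<open>eqs\<close> bounds the distance from
    \<open>x\<close> to \<open>z\<close> below by the sum through \<open>y\<close>; the second
    bounds it above.\<close>
  moreover have "graph_dist G x u \<le> graph_dist G x z + graph_dist G z u"
    "graph_dist G x z \<le> graph_dist G x y + graph_dist G y z"
    using reach verts u by (auto intro!: graph_dist_triangle)
  then have "graph_dist G x z = graph_dist G x y + graph_dist G y z"
    using eqs by linarith
  ultimately show False
    using general_position_set_no_three_aligned[OF X xyz neq] reach verts by blast
qed

end

section \<open>General position sets, extremal numbers and the factor two\<close>

lemma general_position_set_subset:
  assumes "general_position_set G X" "Y \<subseteq> X"
  shows "general_position_set G Y"
proof -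
  \<comment> \<open>Finiteness of \<open>A\<close> matters: an infinite intersection would have
    \<open>card\<close> 0.\<close>
  have "card (A \<inter> Y) \<le> 2" if "card (A \<inter> X) \<le> 2" "finite A" for A
    using that assms(2) card_mono[of "A \<inter> X" "A \<inter> Y"] by fastforce
  then show ?thesis using assms by (auto simp: general_position_set_def)
qed

lemma general_position_set_card_le_two:
  assumes "X \<subseteq> verts G" "finite X" "card X \<le> 2"
  shows "general_position_set G X"
  using assms by (auto simp: general_position_set_def intro: order_trans[OF card_mono])

context fin_digraph
begin

lemma finite_general_position_sets: "finite {X. general_position_set G X}"
  by (rule finite_subset[of _ "Pow (verts G)"]) (auto simp: general_position_set_def)

lemma finite_colinear_sets: "finite {S. colinear_set G u S}"
  using finite_general_position_sets
  by (rule rev_finite_subset) (auto simp: colinear_set_def)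

lemma card_le_gp: "general_position_set G X \<Longrightarrow> card X \<le> gp G"
  unfolding gp_def using finite_general_position_sets by (intro Max_ge) auto

lemma card_le_xi_at: "colinear_set G u S \<Longrightarrow> card S \<le> xi_at G u"
  unfolding xi_at_def using finite_colinear_sets by (intro Max_ge) auto

lemma gp_attained:
  obtains X where "general_position_set G X" "card X = gp G"
proof -
  \<comment> \<open>The empty set makes the family nonempty, so that its \<open>Max\<close> is
    attained.\<close>
  have "general_position_set G {}"
    by (rule general_position_set_card_le_two) auto
  then have "gp G \<in> card ` {X. general_position_set G X}"
    unfolding gp_def using finite_general_position_sets by (intro Max_in) auto
  then show ?thesis using that by auto
qed

lemma xi_at_le_gp: "xi_at G u \<le> gp G"
proof -
  have "colinear_set G u {}"
    by (auto simp: colinear_set_def intro: general_position_set_card_le_two)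
  then show ?thesis
    unfolding xi_at_def using finite_colinear_sets
    by (intro Max.boundedI) (auto dest: colinear_set_def[THEN iffD1] intro: card_le_gp)
qed

lemma gp_ge_two:
  assumes "card (verts G) \<ge> 2"
  shows "gp G \<ge> 2"
proof -
  obtain X where "X \<subseteq> verts G" "card X = 2" "finite X"
    using assms obtain_subset_with_card_n by metis
  then show ?thesis
    using general_position_set_card_le_two card_le_gp by (metis order_refl)
qed

lemma gp_le_twice_xi_at:
  assumes sc: "strongly_connected G" and order: "card (verts G) \<ge> 2" and u: "u \<in> verts G"
  shows "gp G \<le> 2 * xi_at G u"
proof -
  obtain X where X: "general_position_set G X" and cardX: "card X = gp G"
    using gp_attained .
  note chain = general_position_set_chain_le_two[OF X sc u]
  have "finite X"
    using X finite_verts by (auto simp: general_position_set_def intro: finite_subset)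
  show ?thesis
  proof (cases "u \<in> X")
    case True
    \<comment> \<open>As \<open>u\<close> lies below every vertex, two comparable elements of
      \<open>X - {u}\<close> would form a chain of three with \<open>u\<close>.\<close>
    have self: "u \<in> graph_interval G y u" for y
    proof -
      have "graph_dist G u u = 0"
        using graph_dist_le_awalk[of u "[]" u] u by (simp add: awalk_Nil_iff)
      then show ?thesis using u by (simp add: graph_interval_def)
    qed
    have "y \<notin> graph_interval G x u" if "x \<in> X - {u}" "y \<in> X - {u}" "x \<noteq> y" for x y
      using chain[of x y u] that True self by blast
    then have "colinear_set G u (X - {u})"
      using general_position_set_subset[OF X] by (auto simp: colinear_set_def)
    then have "card X - 1 \<le> xi_at G u"
      using card_le_xi_at True \<open>finite X\<close> by fastforce
    \<comment> \<open>For \<open>n \<ge> 2\<close> one has \<open>n \<le> 2 * (n - 1)\<close>; this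
      is where the order of the graph enters.\<close>
    then show ?thesis using gp_ge_two[OF order] cardX by linarith
  next
    case False
    \<comment> \<open>The non-maximal elements of \<open>X\<close>.\<close>
    define L where "L = {y \<in> X. \<exists>x\<in>X. x \<noteq> y \<and> y \<in> graph_interval G x u}"
    \<comment> \<open>An element of \<open>X\<close> above \<open>x\<close> would complete
      \<open>x\<close>, \<open>y\<close> to a chain of three.\<close>
    have "y \<notin> graph_interval G x u" if "x \<in> L" "y \<in> L" "x \<noteq> y" for x y
      using chain that unfolding L_def by blast
    then have "colinear_set G u L"
      using general_position_set_subset[OF X, of L] False
      by (auto simp: colinear_set_def L_def)
    moreover have "colinear_set G u (X - L)"
      using general_position_set_subset[OF X, of "X - L"] False
      by (auto simp: colinear_set_def L_def)
    moreover have "card X = card L + card (X - L)"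
      using \<open>finite X\<close> by (subst card_Un_disjoint[symmetric])
        (auto simp: L_def intro: arg_cong[where f = card])
    ultimately show ?thesis
      using card_le_xi_at[of u L] card_le_xi_at[of u "X - L"] cardX by linarith
  qed
qed

end

theorem theorem3p2:
  fixes G :: "('a, 'b) pre_digraph" and u :: 'a
  assumes "graph G"
    and "Digraph_Component.connected G"
    and "card (verts G) \<ge> 2"
    and "u \<in> verts G"
  shows "xi_min G \<le> xi_at G u \<and> xi_at G u \<le> xi_max G \<and>
         xi_max G \<le> gp G \<and> gp G \<le> 2 * xi_min G"
proof -
  interpret graph G by fact
  \<comment> \<open>Arcs are symmetric, so connectedness yields directed reachability between all
    vertices.\<close>
  have sc: "strongly_connected G"
    using symmetric_connected_imp_strongly_connected sym_arcs assms(2) by blast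
  have fin: "finite (xi_at G ` verts G)" and ne: "xi_at G ` verts G \<noteq> {}"
    using assms(4) by auto
  have "xi_min G \<le> xi_at G u" "xi_at G u \<le> xi_max G"
    unfolding xi_min_def xi_max_def using fin assms(4) by auto
  moreover have "xi_max G \<le> gp G"
    unfolding xi_max_def using fin ne xi_at_le_gp by auto
  \<comment> \<open>The factor-two bound holds at every vertex, in particular at one attaining the
    minimum.\<close>
  moreover have "xi_min G \<in> xi_at G ` verts G"
    unfolding xi_min_def using fin ne by (rule Min_in)
  then have "gp G \<le> 2 * xi_min G"
    using gp_le_twice_xi_at[OF sc assms(3)] by auto
  ultimately show ?thesis by blast
qed

end
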